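(* Let $n\ge2$ and let $(\xi_i)_{i=1,\dots,n}$ be a sequence of independent, symmetric and nondegenerate real-valued random variables. Let $T_n=\sqrt{n}\,\overline{\xi}_n/\widehat{\sigma}$ be Student's $t$-statistic, where $\overline{\xi}_n=\frac1n\sum_{i=1}^n\xi_i$ and $\widehat{\sigma}^2=\sum_{i=1}^n\frac{(\xi_i-\overline{\xi}_n)^2}{n-1}$. Then for all $x>0$, $$\mathbf{P}\big(T_n\ge x\big)\le B_n\bigg(2,\ x\Big(\frac{n}{n+x^2-1}\Big)^{1/2}\bigg).$$
   Context: A real random variable $\xi$ is symmetric (around $0$) if $\xi$ and $-\xi$ have the same distribution. For $0<y<\sqrt{n}$, $$B_n(2,y)=\frac{1}{2^n}\Big(\sqrt{t}+\frac{1}{\sqrt{t}}\Big)^n t^{-\frac12\sqrt{n}\,y},\qquad t=\frac{\sqrt{n}+y}{\sqrt{n}-y},$$ and $B_n(2,\sqrt{n})=2^{-n}$ by convention. For all $x>0$ one has $0<x\big(\frac{n}{n+x^2-1}\big)^{1/2}\le\sqrt{n}$, so the right-hand side of the claim is defined. The statistic's standard deviation is $\widehat{\sigma}=\sqrt{\widehat{\sigma}^2}\ge0$. *)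

theory Defs
  imports "HOL-Probability.Probability"
begin

definition symmetric_rv :: "'a measure \<Rightarrow> ('a \<Rightarrow> real) \<Rightarrow> bool" where
  "symmetric_rv M X \<longleftrightarrow>
     X \<in> borel_measurable M \<and> distr M borel X = distr M borel (\<lambda>\<omega>. - X \<omega>)"

definition nondegenerate_rv :: "'a measure \<Rightarrow> ('a \<Rightarrow> real) \<Rightarrow> bool" where
  "nondegenerate_rv M X \<longleftrightarrow> \<not> (\<exists>c. AE \<omega> in M. X \<omega> = c)"

definition sample_mean :: "nat \<Rightarrow> (nat \<Rightarrow> 'a \<Rightarrow> real) \<Rightarrow> 'a \<Rightarrow> real" where
  "sample_mean n X \<omega> = (1 / real n) * (\<Sum>i=1..n. X i \<omega>)"

definition sample_variance :: "nat \<Rightarrow> (nat \<Rightarrow> 'a \<Rightarrow> real) \<Rightarrow> 'a \<Rightarrow> real" where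
  "sample_variance n X \<omega> = (\<Sum>i=1..n. (X i \<omega> - sample_mean n X \<omega>)\<^sup>2 / (real n - 1))"

definition sample_sd :: "nat \<Rightarrow> (nat \<Rightarrow> 'a \<Rightarrow> real) \<Rightarrow> 'a \<Rightarrow> real" where
  "sample_sd n X \<omega> = sqrt (sample_variance n X \<omega>)"

(* The sample standard deviation may vanish with positive probability (e.g. for random
   signs).  Division in ereal gives the usual convention there: the statistic is infinite,
   with the sign of the mean, when the mean is nonzero, and 0 when both vanish. *)
definition t_statistic :: "nat \<Rightarrow> (nat \<Rightarrow> 'a \<Rightarrow> real) \<Rightarrow> 'a \<Rightarrow> ereal" where
  "t_statistic n X \<omega> =
     ereal (sqrt (real n) * sample_mean n X \<omega>) / ereal (sample_sd n X \<omega>)"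

(* B_n(2, y), meaningful for 0 < y <= sqrt n; the value at y = sqrt n is a convention. *)
definition B2 :: "nat \<Rightarrow> real \<Rightarrow> real" where
  "B2 n y =
     (if y = sqrt (real n) then 1 / 2 ^ n
      else let t = (sqrt (real n) + y) / (sqrt (real n) - y)
           in 1 / 2 ^ n * (sqrt t + 1 / sqrt t) ^ n * t powr (- (1 / 2) * sqrt (real n) * y))"

end

theory Submission
  imports Defs
begin

text \<open>
  Write \<open>S\<close> for the sum of the variables and \<open>V\<close> for the square root of the sum of their
  squares. Student's statistic is an increasing function of the self-normalized sum \<open>S / V\<close>,
  and \<open>T \<ge> x\<close> forces \<open>S / V \<ge> y\<close> with \<open>y = x * sqrt (n / (n + x\<^sup>2 - 1))\<close>
  (\<open>t_statistic_ge_imp_self_normalized_sum_ge\<close>). So it suffices to bound the upper tail of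
  \<open>S / V\<close>, which is done by Markov's inequality for \<open>exp (l * S / V)\<close>.

  The exponential moment is controlled by symmetrization. By independence and symmetry the joint
  law of the variables is invariant under every choice of signs (\<open>distr_PiM_sign_flip\<close>), and a
  change of signs leaves \<open>V\<close> alone. Averaging over all signs therefore replaces
  \<open>exp (l * S / V)\<close> by the product of the factors \<open>cosh (l * X\<^sub>i / V)\<close>. The numbers
  \<open>l * X\<^sub>i / V\<close> have squares adding up to \<open>l\<^sup>2\<close>, and \<open>ln (cosh b)\<close> is a concave function
  of \<open>b\<^sup>2\<close>; by Jensen's inequality the product is largest when all the squares are equal
  (\<open>prod_cosh_le\<close>), so it is at most \<open>cosh (l / sqrt n) ^ n\<close>, whatever the values of the
  variables.

  The resulting bound \<open>cosh (l / sqrt n) ^ n * exp (- l * y)\<close> is minimal in \<open>l\<close> when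
  \<open>tanh (l / sqrt n) = y / sqrt n\<close>, that is, for \<open>l = sqrt n / 2 * ln t\<close> with \<open>t\<close> the
  quotient in the definition of \<open>B2\<close>; its value there is \<open>B2 n y\<close>
  (\<open>B2_eq_cosh_exp\<close>).
\<close>

section \<open>Concavity of ln cosh in the squared argument\<close>

lemma sinh_real_ge_self:
  fixes z :: real
  assumes "0 \<le> z"
  shows "z \<le> sinh z"
proof -
  have "sinh 0 - 0 \<le> sinh z - z"
  proof (rule DERIV_nonneg_imp_nondecreasing[OF assms])
    fix u :: real
    have "((\<lambda>u. sinh u - u) has_real_derivative (cosh u - 1)) (at u)"
      by (auto intro!: derivative_eq_intros)
    then show "\<exists>y. ((\<lambda>u. sinh u - u) has_real_derivative y) (at u) \<and> 0 \<le> y"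
      using cosh_real_ge_1[of u] by force
  qed
  then show ?thesis by simp
qed

text \<open>
  The derivative of \<open>tanh u / u\<close> has the sign of \<open>u - sinh u * cosh u\<close>, which is not positive
  because \<open>sinh u \<ge> u\<close> and \<open>cosh u \<ge> 1\<close>.
\<close>

lemma tanh_over_self_antimono:
  fixes r s :: real
  assumes "0 < s" "s \<le> r"
  shows "tanh r / r \<le> tanh s / s"
proof (rule DERIV_nonpos_imp_nonincreasing[OF assms(2)])
  fix u :: real
  assume "s \<le> u"
  with assms(1) have u: "0 < u" by simp
  have "u * 1 \<le> sinh u * cosh u"
    using u sinh_real_ge_self[of u] cosh_real_ge_1[of u] by (intro mult_mono) auto
  then have "u * 1 / (cosh u)\<^sup>2 \<le> sinh u * cosh u / (cosh u)\<^sup>2"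
    by (intro divide_right_mono) auto
  then have "u * (1 / (cosh u)\<^sup>2) \<le> tanh u"
    by (simp add: tanh_def power2_eq_square)
  moreover have "1 - (tanh u)\<^sup>2 = 1 / (cosh u)\<^sup>2"
    using hyperbolic_pythagoras[of u] cosh_real_pos[of u]
    by (simp add: tanh_def power_divide divide_simps del: cosh_real_pos)
  ultimately have "(1 - (tanh u)\<^sup>2) * u - tanh u * 1 \<le> 0"
    by (simp add: mult.commute)
  then have "((1 - (tanh u)\<^sup>2) * u - tanh u * 1) / (u * u) \<le> 0"
    using u by (intro divide_nonpos_pos) auto
  moreover have "((\<lambda>u. tanh u / u) has_real_derivative
      ((1 - (tanh u)\<^sup>2) * u - tanh u * 1) / (u * u)) (at u)"
    using u cosh_real_pos[of u] by (auto intro!: derivative_eq_intros)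
  ultimately show "\<exists>y. ((\<lambda>u. tanh u / u) has_real_derivative y) (at u) \<and> y \<le> 0"
    by blast
qed

text \<open>
  As a function of \<open>w = b\<^sup>2\<close>, \<open>ln (cosh b)\<close> has derivative \<open>tanh b / (2 * b)\<close>, which is
  decreasing; so the function is concave and lies below its tangent at \<open>w = c\<^sup>2\<close>. Working in
  the variable \<open>b\<close> avoids the singularity of the square root at 0.
\<close>

lemma ln_cosh_le_tangent:
  fixes b c :: real
  assumes "0 < c"
  shows "ln (cosh b) \<le> ln (cosh c) + (b\<^sup>2 - c\<^sup>2) * (tanh c / (2 * c))"
proof -
  define g where "g u = (u\<^sup>2 - c\<^sup>2) * (tanh c / (2 * c)) - ln (cosh u)" for u
  have deriv: "(g has_real_derivative u * (tanh c / c) - tanh u) (at u)" for u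
    unfolding g_def using assms cosh_real_pos[of u]
    by (auto intro!: derivative_eq_intros simp: tanh_def)
  have "g c \<le> g \<bar>b\<bar>"
  proof (cases "c \<le> \<bar>b\<bar>")
    case True
    then show ?thesis
    proof (rule DERIV_nonneg_imp_nondecreasing)
      fix u assume "c \<le> u"
      then have "tanh u / u \<le> tanh c / c"
        using assms by (intro tanh_over_self_antimono)
      then have "0 \<le> u * (tanh c / c) - tanh u"
        using assms \<open>c \<le> u\<close> by (simp add: pos_divide_le_eq mult.commute)
      with deriv show "\<exists>y. (g has_real_derivative y) (at u) \<and> 0 \<le> y" by blast
    qed
  next
    case False
    then have "\<bar>b\<bar> \<le> c" by simp
    then show ?thesis
    proof (rule DERIV_nonpos_imp_nonincreasing)
      fix u assume u: "\<bar>b\<bar> \<le> u" "u \<le> c"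
      have "u * (tanh c / c) - tanh u \<le> 0"
      proof (cases "u = 0")
        case False
        with u have "0 < u" by linarith
        with u have "tanh c / c \<le> tanh u / u"
          by (intro tanh_over_self_antimono)
        with \<open>0 < u\<close> show ?thesis by (simp add: pos_le_divide_eq mult.commute)
      qed simp
      with deriv show "\<exists>y. (g has_real_derivative y) (at u) \<and> y \<le> 0" by blast
    qed
  qed
  then show ?thesis by (simp add: g_def abs_if split: if_splits)
qed

text \<open>
  Jensen's inequality for \<open>ln (cosh b)\<close> as a function of \<open>b\<^sup>2\<close>: when the tangent bounds are
  summed over \<open>I\<close>, the linear terms contribute at most 0.
\<close>

lemma prod_cosh_le:
  fixes b :: "'i \<Rightarrow> real" and c :: real
  assumes "finite I" "0 < c" "(\<Sum>i\<in>I. (b i)\<^sup>2) \<le> real (card I) * c\<^sup>2"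
  shows "(\<Prod>i\<in>I. cosh (b i)) \<le> cosh c ^ card I"
proof -
  have "(\<Sum>i\<in>I. ln (cosh (b i))) \<le> (\<Sum>i\<in>I. ln (cosh c) + ((b i)\<^sup>2 - c\<^sup>2) * (tanh c / (2 * c)))"
    by (intro sum_mono ln_cosh_le_tangent assms)
  also have "\<dots> = real (card I) * ln (cosh c)
      + ((\<Sum>i\<in>I. (b i)\<^sup>2) - real (card I) * c\<^sup>2) * (tanh c / (2 * c))"
    by (simp add: sum.distrib sum_subtractf sum_distrib_right[symmetric] del: times_divide_eq_right)
  also have "\<dots> \<le> real (card I) * ln (cosh c)"
    using assms mult_nonpos_nonneg[of "(\<Sum>i\<in>I. (b i)\<^sup>2) - real (card I) * c\<^sup>2" "tanh c / (2 * c)"]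
    by simp
  finally have "ln (\<Prod>i\<in>I. cosh (b i)) \<le> ln (cosh c ^ card I)"
    using assms(1) by (simp add: ln_prod ln_realpow)
  then show ?thesis
    by (simp add: prod_pos)
qed

section \<open>Random signs and exponential moments of the self-normalized sum\<close>

lemma sum_exp_signs_eq_prod_cosh:
  fixes a :: "'i \<Rightarrow> real"
  assumes "finite I"
  shows "(\<Sum>e\<in>I \<rightarrow>\<^sub>E {-1, 1}. exp (\<Sum>i\<in>I. e i * a i)) = 2 ^ card I * (\<Prod>i\<in>I. cosh (a i))"
proof -
  have "(\<Sum>e\<in>I \<rightarrow>\<^sub>E {-1, 1::real}. exp (\<Sum>i\<in>I. e i * a i))
      = (\<Prod>i\<in>I. \<Sum>s\<in>{-1, 1}. exp (s * a i))"
    using assms by (subst prod_sum_PiE) (auto simp: exp_sum)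
  also have "\<dots> = (\<Prod>i\<in>I. 2 * cosh (a i))"
    by (intro prod.cong) (auto simp: cosh_field_def)
  finally show ?thesis
    by (simp add: prod.distrib)
qed

text \<open>
  The quotient \<open>S / V\<close>, divided termwise; it is 0 when all the entries vanish.
\<close>

definition self_normalized_sum :: "'i set \<Rightarrow> ('i \<Rightarrow> real) \<Rightarrow> real" where
  "self_normalized_sum I v = (\<Sum>i\<in>I. v i / sqrt (\<Sum>j\<in>I. (v j)\<^sup>2))"

lemma self_normalized_sum_restrict:
  "self_normalized_sum I (\<lambda>i\<in>I. v i) = self_normalized_sum I v"
  by (simp add: self_normalized_sum_def)

lemma self_normalized_sum_signs:
  assumes "\<And>i. i \<in> I \<Longrightarrow> e i \<in> {-1, 1}"
  shows "self_normalized_sum I (\<lambda>i. e i * v i)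
       = (\<Sum>i\<in>I. e i * (v i / sqrt (\<Sum>j\<in>I. (v j)\<^sup>2)))"
proof -
  have "(\<Sum>j\<in>I. (e j * v j)\<^sup>2) = (\<Sum>j\<in>I. (v j)\<^sup>2)"
    using assms power2_eq_1_iff by (intro sum.cong) (force simp: power_mult_distrib)+
  then show ?thesis by (simp add: self_normalized_sum_def)
qed

text \<open>
  Each term has absolute value at most 1. This crude bound serves for the integrability of the
  exponential of a self-normalized sum.
\<close>

lemma abs_self_normalized_sum_le:
  assumes "finite I"
  shows "\<bar>self_normalized_sum I v\<bar> \<le> real (card I)"
proof -
  have "\<bar>v i / sqrt (\<Sum>j\<in>I. (v j)\<^sup>2)\<bar> \<le> 1" if "i \<in> I" for i
  proof -
    have "(v i)\<^sup>2 \<le> (\<Sum>j\<in>I. (v j)\<^sup>2)"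
      using assms that by (intro member_le_sum) auto
    then have "\<bar>v i\<bar> \<le> sqrt (\<Sum>j\<in>I. (v j)\<^sup>2)"
      using real_sqrt_le_mono by fastforce
    moreover have "0 \<le> sqrt (\<Sum>j\<in>I. (v j)\<^sup>2)"
      by (simp add: sum_nonneg)
    ultimately show ?thesis
      unfolding abs_divide by (simp only: abs_of_nonneg divide_le_eq_1) auto
  qed
  then have "(\<Sum>i\<in>I. \<bar>v i / sqrt (\<Sum>j\<in>I. (v j)\<^sup>2)\<bar>) \<le> (\<Sum>i\<in>I. 1)"
    by (intro sum_mono)
  then show ?thesis
    unfolding self_normalized_sum_def by (simp add: order_trans[OF sum_abs] del: abs_divide)
qed

lemma borel_measurable_self_normalized_sum [measurable]:
  "self_normalized_sum I \<in> borel_measurable (\<Pi>\<^sub>M i\<in>I. borel)"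
  unfolding self_normalized_sum_def
  by measurable

text \<open>
  The pointwise core of the moment bound. Since the signs do not change the normalization, the
  sum over them factors into hyperbolic cosines, to which the Jensen bound applies with
  \<open>c = l / sqrt (card I)\<close>.
\<close>

lemma signs_average_exp_self_normalized_sum_le:
  fixes v :: "'i \<Rightarrow> real"
  assumes "finite I" "I \<noteq> {}" "0 < l"
  shows "(\<Sum>e\<in>I \<rightarrow>\<^sub>E {-1, 1}. exp (l * self_normalized_sum I (\<lambda>i. e i * v i)))
       \<le> 2 ^ card I * cosh (l / sqrt (card I)) ^ card I"
proof -
  define Q where "Q = (\<Sum>j\<in>I. (v j)\<^sup>2)"
  have "Q \<ge> 0" by (simp add: Q_def sum_nonneg)
  have card: "0 < card I" using assms by (simp add: card_gt_0_iff)
  have "l * self_normalized_sum I (\<lambda>i. e i * v i) = (\<Sum>i\<in>I. e i * (l * (v i / sqrt Q)))"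
    if "e \<in> I \<rightarrow>\<^sub>E {-1, 1}" for e
  proof -
    have "e i \<in> {-1, 1}" if "i \<in> I" for i
      using \<open>e \<in> I \<rightarrow>\<^sub>E {-1, 1}\<close> that by (rule PiE_mem)
    from self_normalized_sum_signs[of I e v, OF this] show ?thesis
      by (simp add: Q_def sum_distrib_left mult.left_commute)
  qed
  then have "(\<Sum>e\<in>I \<rightarrow>\<^sub>E {-1, 1}. exp (l * self_normalized_sum I (\<lambda>i. e i * v i)))
      = 2 ^ card I * (\<Prod>i\<in>I. cosh (l * (v i / sqrt Q)))"
    using sum_exp_signs_eq_prod_cosh[OF assms(1), of "\<lambda>i. l * (v i / sqrt Q)"] by simp
  moreover have "(\<Prod>i\<in>I. cosh (l * (v i / sqrt Q))) \<le> cosh (l / sqrt (card I)) ^ card I"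
  proof (rule prod_cosh_le[OF assms(1)])
    have "(\<Sum>i\<in>I. (l * (v i / sqrt Q))\<^sup>2) = (\<Sum>i\<in>I. l\<^sup>2 / Q * (v i)\<^sup>2)"
      using \<open>Q \<ge> 0\<close> by (simp add: power_mult_distrib power_divide)
    also have "\<dots> = l\<^sup>2 / Q * Q"
      unfolding Q_def by (rule sum_distrib_left[symmetric])
    \<comment> \<open>Equality, except that the left side is 0 when all the entries vanish.\<close>
    also have "\<dots> \<le> l\<^sup>2" by (cases "Q = 0") auto
    also have "\<dots> = real (card I) * (l / sqrt (card I))\<^sup>2"
      using card by (simp add: power_divide)
    finally show "(\<Sum>i\<in>I. (l * (v i / sqrt Q))\<^sup>2) \<le> real (card I) * (l / sqrt (card I))\<^sup>2" .
  qed (use assms card in auto)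
  ultimately show ?thesis by simp
qed

context prob_space
begin

lemma distr_sign_flip:
  assumes "symmetric_rv M Y" "s \<in> {-1, 1}"
  shows "distr M borel (\<lambda>\<omega>. s * Y \<omega>) = distr M borel Y"
  using assms by (auto simp: symmetric_rv_def)

text \<open>
  Independence makes the joint law the product of the marginal laws, and by symmetry none of
  these is changed by a sign.
\<close>

lemma distr_PiM_sign_flip:
  fixes X :: "'i \<Rightarrow> 'a \<Rightarrow> real"
  assumes "I \<noteq> {}" "indep_vars (\<lambda>_. borel) X I"
    and sym: "\<And>i. i \<in> I \<Longrightarrow> symmetric_rv M (X i)"
    and e: "\<And>i. i \<in> I \<Longrightarrow> e i \<in> {-1, 1}"
  shows "distr M (\<Pi>\<^sub>M i\<in>I. borel) (\<lambda>\<omega>. \<lambda>i\<in>I. e i * X i \<omega>)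
       = distr M (\<Pi>\<^sub>M i\<in>I. borel) (\<lambda>\<omega>. \<lambda>i\<in>I. X i \<omega>)"
proof -
  have rv: "X i \<in> borel_measurable M" if "i \<in> I" for i
    using sym[OF that] by (simp add: symmetric_rv_def)
  have indep: "indep_vars (\<lambda>_. borel) (\<lambda>i \<omega>. e i * X i \<omega>) I"
    by (rule indep_vars_compose2[OF assms(2)]) simp
  have "distr M (\<Pi>\<^sub>M i\<in>I. borel) (\<lambda>\<omega>. \<lambda>i\<in>I. e i * X i \<omega>)
      = (\<Pi>\<^sub>M i\<in>I. distr M borel (\<lambda>\<omega>. e i * X i \<omega>))"
    using indep_vars_iff_distr_eq_PiM'[OF assms(1), of "\<lambda>i \<omega>. e i * X i \<omega>" "\<lambda>_. borel"]
      rv indep by simp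
  also have "\<dots> = (\<Pi>\<^sub>M i\<in>I. distr M borel (X i))"
    by (intro PiM_cong refl distr_sign_flip sym e)
  also have "\<dots> = distr M (\<Pi>\<^sub>M i\<in>I. borel) (\<lambda>\<omega>. \<lambda>i\<in>I. X i \<omega>)"
    using indep_vars_iff_distr_eq_PiM'[OF assms(1), of X "\<lambda>_. borel"] rv assms(2) by simp
  finally show ?thesis .
qed

text \<open>
  The expectation is the same for all \<open>2 ^ card I\<close> choices of signs, hence equals the
  expectation of their average, and that average is bounded pointwise.
\<close>

lemma expectation_exp_self_normalized_sum_le:
  fixes X :: "'i \<Rightarrow> 'a \<Rightarrow> real"
  assumes fin: "finite I" and ne: "I \<noteq> {}"
    and indep: "indep_vars (\<lambda>_. borel) X I"
    and sym: "\<And>i. i \<in> I \<Longrightarrow> symmetric_rv M (X i)"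
    and "0 < l"
  shows "integrable M (\<lambda>\<omega>. exp (l * self_normalized_sum I (\<lambda>i. X i \<omega>)))"
    and "expectation (\<lambda>\<omega>. exp (l * self_normalized_sum I (\<lambda>i. X i \<omega>)))
           \<le> cosh (l / sqrt (card I)) ^ card I"
proof -
  define F where "F v = exp (l * self_normalized_sum I v)" for v
  define L where "L = expectation (\<lambda>\<omega>. F (\<lambda>i. X i \<omega>))"
  have [measurable]: "F \<in> borel_measurable (\<Pi>\<^sub>M i\<in>I. borel)"
    unfolding F_def by measurable
  have rv: "X i \<in> borel_measurable M" if "i \<in> I" for i
    using sym[OF that] by (simp add: symmetric_rv_def)
  have F_restrict: "F (\<lambda>i\<in>I. v i) = F v" for v
    by (simp add: F_def self_normalized_sum_restrict)
  have vec: "(\<lambda>\<omega>. \<lambda>i\<in>I. e i * X i \<omega>) \<in> measurable M (\<Pi>\<^sub>M i\<in>I. borel)" for e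
    using rv by (intro measurable_restrict borel_measurable_times) auto
  have F_meas: "(\<lambda>\<omega>. F (\<lambda>i. e i * X i \<omega>)) \<in> borel_measurable M" for e
    using measurable_compose[OF vec[of e], of F borel] by (simp add: F_restrict)
  have F_le: "\<bar>F v\<bar> \<le> exp (l * real (card I))" for v
    using abs_self_normalized_sum_le[OF fin, of v] \<open>0 < l\<close> by (simp add: F_def)
  have F_int: "integrable M (\<lambda>\<omega>. F (\<lambda>i. e i * X i \<omega>))" for e
    by (rule integrable_const_bound[OF _ F_meas]) (use F_le in auto)
  show "integrable M (\<lambda>\<omega>. exp (l * self_normalized_sum I (\<lambda>i. X i \<omega>)))"
    using F_int[of "\<lambda>_. 1"] by (simp add: F_def)
  have flip: "expectation (\<lambda>\<omega>. F (\<lambda>i. e i * X i \<omega>)) = L" if "e \<in> I \<rightarrow>\<^sub>E {-1, 1}" for e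
  proof -
    have e: "e i \<in> {-1, 1}" if "i \<in> I" for i
      using \<open>e \<in> I \<rightarrow>\<^sub>E {-1, 1}\<close> that by (rule PiE_mem)
    have "expectation (\<lambda>\<omega>. F (\<lambda>i. e i * X i \<omega>))
        = integral\<^sup>L (distr M (\<Pi>\<^sub>M i\<in>I. borel) (\<lambda>\<omega>. \<lambda>i\<in>I. e i * X i \<omega>)) F"
      by (subst integral_distr[OF vec]) (auto simp: F_restrict)
    also have "\<dots> = integral\<^sup>L (distr M (\<Pi>\<^sub>M i\<in>I. borel) (\<lambda>\<omega>. \<lambda>i\<in>I. X i \<omega>)) F"
      using distr_PiM_sign_flip[OF ne indep sym e] by simp
    also have "\<dots> = L"
      using vec[of "\<lambda>_. 1"] by (subst integral_distr) (auto simp: F_restrict L_def)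
    finally show ?thesis .
  qed
  have "card (I \<rightarrow>\<^sub>E {-1, 1::real}) = 2 ^ card I"
    by (simp add: card_PiE fin numeral_2_eq_2)
  then have "2 ^ card I * L = (\<Sum>e\<in>I \<rightarrow>\<^sub>E {-1, 1}. expectation (\<lambda>\<omega>. F (\<lambda>i. e i * X i \<omega>)))"
    by (simp add: flip)
  also have "\<dots> = expectation (\<lambda>\<omega>. \<Sum>e\<in>I \<rightarrow>\<^sub>E {-1, 1}. F (\<lambda>i. e i * X i \<omega>))"
    by (intro Bochner_Integration.integral_sum[symmetric] F_int)
  also have "\<dots> \<le> expectation (\<lambda>_. 2 ^ card I * cosh (l / sqrt (card I)) ^ card I)"
    unfolding F_def
    by (intro integral_mono Bochner_Integration.integrable_sum F_int[unfolded F_def]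
        integrable_const signs_average_exp_self_normalized_sum_le fin ne \<open>0 < l\<close>)
  also have "\<dots> = 2 ^ card I * cosh (l / sqrt (card I)) ^ card I"
    by (simp add: prob_space)
  finally show "expectation (\<lambda>\<omega>. exp (l * self_normalized_sum I (\<lambda>i. X i \<omega>)))
           \<le> cosh (l / sqrt (card I)) ^ card I"
    by (simp add: L_def F_def)
qed

lemma prob_self_normalized_sum_ge_le:
  fixes X :: "'i \<Rightarrow> 'a \<Rightarrow> real"
  assumes "finite I" "I \<noteq> {}" "indep_vars (\<lambda>_. borel) X I"
    and "\<And>i. i \<in> I \<Longrightarrow> symmetric_rv M (X i)"
    and "0 < l"
  shows "{\<omega> \<in> space M. y \<le> self_normalized_sum I (\<lambda>i. X i \<omega>)} \<in> events"
    and "prob {\<omega> \<in> space M. y \<le> self_normalized_sum I (\<lambda>i. X i \<omega>)}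
           \<le> cosh (l / sqrt (card I)) ^ card I * exp (- l * y)"
proof -
  let ?Z = "\<lambda>\<omega>. self_normalized_sum I (\<lambda>i. X i \<omega>)"
  note moment = expectation_exp_self_normalized_sum_le[OF assms]
  have event: "{\<omega> \<in> space M. y \<le> ?Z \<omega>} = {\<omega> \<in> space M. exp (l * y) \<le> exp (l * ?Z \<omega>)}"
    using \<open>0 < l\<close> by simp
  have [measurable]: "(\<lambda>\<omega>. exp (l * ?Z \<omega>)) \<in> borel_measurable M"
    using moment(1) by (rule borel_measurable_integrable)
  show "{\<omega> \<in> space M. y \<le> ?Z \<omega>} \<in> events"
    unfolding event by measurable
  have "prob {\<omega> \<in> space M. y \<le> ?Z \<omega>} \<le> expectation (\<lambda>\<omega>. exp (l * ?Z \<omega>)) / exp (l * y)"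
    unfolding event using moment(1)
    by (rule integral_Markov_inequality_measure[where A = "{}"]) auto
  also have "\<dots> \<le> cosh (l / sqrt (card I)) ^ card I / exp (l * y)"
    by (rule divide_right_mono[OF moment(2)]) simp_all
  finally show "prob {\<omega> \<in> space M. y \<le> ?Z \<omega>}
      \<le> cosh (l / sqrt (card I)) ^ card I * exp (- l * y)"
    by (simp add: exp_minus divide_inverse)
qed

end

section \<open>Student's statistic and the choice of the exponent\<close>

lemma sample_variance_eq:
  assumes "n \<ge> 2"
  shows "sample_variance n X \<omega>
       = ((\<Sum>i=1..n. (X i \<omega>)\<^sup>2) - (\<Sum>i=1..n. X i \<omega>)\<^sup>2 / n) / (real n - 1)"
proof -
  define m where "m = sample_mean n X \<omega>"
  have S: "(\<Sum>i=1..n. X i \<omega>) = n * m"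
    using assms by (simp add: m_def sample_mean_def)
  have "(\<Sum>i=1..n. (X i \<omega> - m)\<^sup>2)
      = (\<Sum>i=1..n. (X i \<omega>)\<^sup>2) - 2 * m * (\<Sum>i=1..n. X i \<omega>) + n * m\<^sup>2"
    by (simp add: power2_diff sum.distrib sum_subtractf sum_distrib_left algebra_simps)
  also have "\<dots> = (\<Sum>i=1..n. (X i \<omega>)\<^sup>2) - (\<Sum>i=1..n. X i \<omega>)\<^sup>2 / n"
    unfolding S using assms by (simp add: power2_eq_square)
  finally show ?thesis
    by (simp add: sample_variance_def m_def sum_divide_distrib[symmetric])
qed

text \<open>
  With \<open>\<sigma>\<close> the sample standard deviation, \<open>T \<ge> x\<close> gives \<open>S > 0\<close> and
  \<open>x * \<sigma> \<le> S / sqrt n\<close>. Squaring the latter and expressing \<open>\<sigma>\<^sup>2\<close> through \<open>S\<close> and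
  \<open>Q = V\<^sup>2\<close> yields an inequality that is linear in \<open>S\<^sup>2\<close> and \<open>Q\<close>. The degenerate case
  \<open>\<sigma> = 0\<close> only needs \<open>S > 0\<close>: there \<open>T\<close> is \<open>\<infinity>\<close>, 0 or \<open>-\<infinity>\<close> according to the
  sign of \<open>S\<close>.
\<close>

lemma t_statistic_ge_imp_self_normalized_sum_ge:
  assumes "n \<ge> 2" "0 < x" "t_statistic n X \<omega> \<ge> ereal x"
  shows "x * sqrt (real n / (real n + x\<^sup>2 - 1)) \<le> self_normalized_sum {1..n} (\<lambda>i. X i \<omega>)"
proof -
  define S where "S = (\<Sum>i=1..n. X i \<omega>)"
  define Q where "Q = (\<Sum>i=1..n. (X i \<omega>)\<^sup>2)"
  define \<sigma> where "\<sigma> = sample_sd n X \<omega>"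
  have n: "real n \<ge> 2" using assms(1) by simp
  have var_nonneg: "0 \<le> sample_variance n X \<omega>"
    unfolding sample_variance_def using n by (intro sum_nonneg divide_nonneg_pos) auto
  then have "0 \<le> \<sigma>" by (simp add: \<sigma>_def sample_sd_def)
  have mean: "sqrt n * sample_mean n X \<omega> = S / sqrt n"
    using n by (simp add: S_def sample_mean_def real_div_sqrt field_simps)
  have T: "ereal x \<le> ereal (S / sqrt n) / ereal \<sigma>"
    using assms(3) by (simp add: t_statistic_def mean \<sigma>_def)
  have "0 < S \<and> x * \<sigma> \<le> S / sqrt n"
  proof (cases "\<sigma> = 0")
    case True
    have "0 < S"
    proof (rule ccontr)
      assume "\<not> 0 < S"
      then have "S / sqrt n \<le> 0"
        using n by (auto simp: divide_le_0_iff)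
      then have "ereal (S / sqrt n) * \<infinity> \<le> 0"
        by (cases "S / sqrt n = 0") (auto simp: zero_ereal_def[symmetric])
      moreover have "ereal (S / sqrt n) / ereal \<sigma> = ereal (S / sqrt n) * \<infinity>"
        unfolding ereal_divide using True by simp
      ultimately have "ereal (S / sqrt n) / ereal \<sigma> \<le> 0" by (simp only:)
      with T \<open>0 < x\<close> show False
        by (metis ereal_less(2) leD order_trans)
    qed
    with True n show ?thesis by simp
  next
    case False
    with \<open>0 \<le> \<sigma>\<close> have "0 < \<sigma>" by simp
    with T have "x \<le> S / sqrt n / \<sigma>" by simp
    with \<open>0 < \<sigma>\<close> have "x * \<sigma> \<le> S / sqrt n" by (simp only: pos_le_divide_eq)
    moreover from this \<open>0 < x\<close> \<open>0 < \<sigma>\<close> have "0 < S / sqrt n"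
      by (meson mult_pos_pos less_le_trans)
    ultimately show ?thesis using n by (simp add: zero_less_divide_iff)
  qed
  then have "0 < S" and le: "x * \<sigma> \<le> S / sqrt n" by auto
  have "(x * \<sigma>)\<^sup>2 \<le> (S / sqrt n)\<^sup>2"
    using le \<open>0 < x\<close> \<open>0 \<le> \<sigma>\<close> by (intro power_mono) auto
  moreover have "\<sigma>\<^sup>2 = (Q - S\<^sup>2 / n) / (real n - 1)"
    using var_nonneg
    by (simp add: \<sigma>_def sample_sd_def sample_variance_eq[OF assms(1)] S_def Q_def)
  ultimately have "x\<^sup>2 * ((Q - S\<^sup>2 / n) / (real n - 1)) \<le> S\<^sup>2 / n"
    by (simp add: power_mult_distrib power_divide)
  also have "x\<^sup>2 * ((Q - S\<^sup>2 / n) / (real n - 1)) = x\<^sup>2 * (n * Q - S\<^sup>2) / (real n - 1) / n"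
  proof -
    have "Q - S\<^sup>2 / n = (n * Q - S\<^sup>2) / n"
      using n by (simp add: diff_divide_distrib)
    then show ?thesis by (simp only: times_divide_eq_right divide_divide_eq_left mult.commute)
  qed
  finally have "x\<^sup>2 * (n * Q - S\<^sup>2) / (real n - 1) \<le> S\<^sup>2"
    using n by (simp only: divide_le_cancel)
  then have "x\<^sup>2 * (n * Q - S\<^sup>2) \<le> S\<^sup>2 * (real n - 1)"
    using n by (simp add: pos_divide_le_eq)
  then have "x\<^sup>2 * n * Q \<le> S\<^sup>2 * (real n + x\<^sup>2 - 1)"
    by (simp add: algebra_simps)
  moreover have D: "0 < real n + x\<^sup>2 - 1"
    using n by (smt (verit) zero_le_power2)
  ultimately have "x\<^sup>2 * (real n / (real n + x\<^sup>2 - 1)) * Q \<le> S\<^sup>2"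
    by (simp add: pos_divide_le_eq)
  then have "sqrt (x\<^sup>2 * (real n / (real n + x\<^sup>2 - 1)) * Q) \<le> sqrt (S\<^sup>2)"
    by (rule real_sqrt_le_mono)
  then have ySQ: "x * sqrt (real n / (real n + x\<^sup>2 - 1)) * sqrt Q \<le> S"
    using \<open>0 < x\<close> \<open>0 < S\<close>
    by (simp add: real_sqrt_mult del: times_divide_eq_left times_divide_eq_right)
  have "Q \<noteq> 0"
  proof
    assume "Q = 0"
    then have "\<forall>i\<in>{1..n}. (X i \<omega>)\<^sup>2 = 0"
      unfolding Q_def by (subst (asm) sum_nonneg_eq_0_iff) auto
    then have "S = 0" by (simp add: S_def)
    with \<open>0 < S\<close> show False by simp
  qed
  moreover have "0 \<le> Q" by (simp add: Q_def sum_nonneg)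
  ultimately have "0 < sqrt Q" by simp
  with ySQ have "x * sqrt (real n / (real n + x\<^sup>2 - 1)) \<le> S / sqrt Q"
    by (simp add: pos_le_divide_eq)
  then show ?thesis
    by (simp add: self_normalized_sum_def S_def Q_def sum_divide_distrib)
qed

text \<open>
  The exponent is chosen so that \<open>exp (l / sqrt n) = sqrt t\<close>, which turns the hyperbolic cosine
  into half of \<open>sqrt t + 1 / sqrt t\<close>.
\<close>

lemma B2_eq_cosh_exp:
  fixes y :: real
  assumes "0 < y" "y < sqrt n"
  defines "l \<equiv> sqrt n / 2 * ln ((sqrt n + y) / (sqrt n - y))"
  shows "0 < l" and "B2 n y = cosh (l / sqrt n) ^ n * exp (- l * y)"
proof -
  define t where "t = (sqrt n + y) / (sqrt n - y)"
  have t: "1 < t" using assms(1,2) by (simp add: t_def)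
  have n: "0 < sqrt n" using assms(1,2) by linarith
  show "0 < l" using t n by (simp add: l_def t_def[symmetric])
  have "l / sqrt n = ln (sqrt t)"
    using n t by (simp add: l_def t_def[symmetric] ln_sqrt)
  then have "cosh (l / sqrt n) = (sqrt t + 1 / sqrt t) / 2"
    using t by (simp add: cosh_ln_real inverse_eq_divide)
  moreover have "exp (- l * y) = t powr (- (1 / 2) * sqrt n * y)"
    using t by (simp add: powr_def l_def t_def[symmetric] mult_ac)
  moreover have "B2 n y
      = ((sqrt t + 1 / sqrt t) / 2) ^ n * t powr (- (1 / 2) * sqrt n * y)"
    using assms(2) by (simp add: B2_def t_def Let_def power_divide)
  ultimately show "B2 n y = cosh (l / sqrt n) ^ n * exp (- l * y)"
    by (simp only:)
qed

theorem theorem2p2: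
  fixes M :: "'a measure" and X :: "nat \<Rightarrow> 'a \<Rightarrow> real" and n :: nat and x :: real
  assumes "prob_space M"
    and "n \<ge> 2"
    and "prob_space.indep_vars M (\<lambda>_. borel) X {1..n}"
    and "\<And>i. i \<in> {1..n} \<Longrightarrow> symmetric_rv M (X i)"
    and "\<And>i. i \<in> {1..n} \<Longrightarrow> nondegenerate_rv M (X i)"
    and "x > 0"
  shows "measure M {\<omega> \<in> space M. t_statistic n X \<omega> \<ge> ereal x}
           \<le> B2 n (x * sqrt (real n / (real n + x\<^sup>2 - 1)))"
proof -
  interpret prob_space M by fact
  define y where "y = x * sqrt (real n / (real n + x\<^sup>2 - 1))"
  define l where "l = sqrt n / 2 * ln ((sqrt n + y) / (sqrt n - y))"
  have n: "real n \<ge> 2" using assms(2) by simp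
  have x2: "0 < x\<^sup>2" using assms(6) by simp
  have D: "0 < real n + x\<^sup>2 - 1" using n x2 by linarith
  have "0 < y" using n D assms(6) by (simp add: y_def)
  \<comment> \<open>As \<open>n > 1\<close>, \<open>y\<close> stays strictly below \<open>sqrt n\<close>, so the conventional value of
    \<open>B2 n\<close> at \<open>sqrt n\<close> does not occur.\<close>
  have "y = sqrt (x\<^sup>2 * (real n / (real n + x\<^sup>2 - 1)))"
    using assms(6) by (simp add: y_def real_sqrt_mult del: times_divide_eq_right)
  also have "\<dots> = sqrt (real n * (x\<^sup>2 / (real n + x\<^sup>2 - 1)))"
    by (simp add: mult.commute)
  also have "\<dots> < sqrt (real n * 1)"
    using n D by (intro real_sqrt_less_mono mult_strict_left_mono) (auto simp: divide_less_eq)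
  finally have "y < sqrt n" by simp
  note B2 = B2_eq_cosh_exp[OF \<open>0 < y\<close> \<open>y < sqrt n\<close>, folded l_def]
  have I: "finite {1..n}" "{1..n} \<noteq> {}" using assms(2) by auto
  note tail = prob_self_normalized_sum_ge_le[OF I assms(3,4) B2(1), where y = y]
  have "measure M {\<omega> \<in> space M. t_statistic n X \<omega> \<ge> ereal x}
      \<le> prob {\<omega> \<in> space M. y \<le> self_normalized_sum {1..n} (\<lambda>i. X i \<omega>)}"
    using t_statistic_ge_imp_self_normalized_sum_ge[OF assms(2,6)]
    by (intro finite_measure_mono tail(1)) (auto simp: y_def)
  also have "\<dots> \<le> B2 n y"
    using tail(2) by (simp add: B2(2))
  finally show ?thesis by (simp add: y_def)
qed

end
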